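(* Let $n\ge 1$ be an integer and write $2n$ in base $10$ as $2n=\sum_{k=0}^{m}a_k\cdot 10^k$, where $m+1$ is the number of decimal digits of $2n$, so that $a_0\in\{0,2,4,6,8\}$ (i.e. $2\mid a_0$), $0\le a_k\le 9$ for all $k$, and $a_m\neq 0$. Then \[ a(n)=C(2\rightarrow 2n)=C\Bigl(2\rightarrow\sum_{k=0}^{m}a_k\cdot 10^k\Bigr) \] and \[ a(n)=\frac{5}{11}\bigl(45^{m}-1\bigr)+\sum_{k=1}^{m}\Bigl[\prod_{k<j\le m}a_j\Bigr]\Bigl[2\cdot 5^{k}\cdot 9^{k-1}\cdot a_k\,(a_k-1)\Bigr]+\Bigl[\prod_{i=1}^{m}a_i\Bigr]\Bigl[\frac{a_0^{2}}{4}+\frac{a_0}{2}\Bigr]. \]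
   Context: For a positive integer $p$, $C(p)$ denotes the product of the decimal digits of $p$ (no leading zeros). For $n\ge 1$, $a(n)=\sum_{i=1}^{n}C(2i)$ is the sum of the products of the digits of the first $n$ positive even numbers $2,4,\dots,2n$ (with $a(0)=0$). For positive even integers $b\le c$, $C(b\rightarrow c)=a(c/2)-a(b/2-1)$ is the sum of $C(p)$ over all even integers $p$ with $b\le p\le c$. Empty products are equal to $1$ and empty sums are equal to $0$. *)

theory Defs
  imports Complex_Main
begin

definition num_digits :: "nat \<Rightarrow> nat" where
  "num_digits p = (LEAST d. p < 10 ^ d)"

definition digit :: "nat \<Rightarrow> nat \<Rightarrow> nat" where
  "digit p k = p div 10 ^ k mod 10"

text \<open>\<open>C(p)\<close>; only meaningful for positive \<open>p\<close> (at \<open>0\<close> it is the empty product).\<close>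

definition digit_prod :: "nat \<Rightarrow> nat" where
  "digit_prod p = (\<Prod>k<num_digits p. digit p k)"

text \<open>\<open>a(n)\<close>\<close>

definition even_sum :: "nat \<Rightarrow> nat" where
  "even_sum n = (\<Sum>i=1..n. digit_prod (2 * i))"

text \<open>\<open>C(b \<rightarrow> c)\<close>, for positive even \<open>b \<le> c\<close>. It is also \<open>a(c/2) - a(b/2 - 1)\<close>,
  by \<open>between_sum_eq_diff\<close> below.\<close>

definition between_sum :: "nat \<Rightarrow> nat \<Rightarrow> nat" where
  "between_sum b c = (\<Sum>p | even p \<and> b \<le> p \<and> p \<le> c. digit_prod p)"

lemma between_sum_eq_diff:
  assumes "even b" "even c" "0 < b" "b \<le> c"
  shows "int (between_sum b c) = int (even_sum (c div 2)) - int (even_sum (b div 2 - 1))"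
proof -
  obtain k l where bc: "b = 2 * k" "c = 2 * l"
    using assms(1,2) by (auto elim!: evenE)
  have k: "1 \<le> k" "k \<le> l" using assms bc by auto
  have "{p. even p \<and> b \<le> p \<and> p \<le> c} = (\<lambda>i. 2 * i) ` {k..l}"
    using bc by (auto elim!: evenE)
  then have "between_sum b c = (\<Sum>i=k..l. digit_prod (2 * i))"
    unfolding between_sum_def by (simp add: sum.reindex inj_on_def)
  moreover have "{1..l} = {1..k - 1} \<union> {k..l}" "{1..k - 1} \<inter> {k..l} = {}"
    using k by auto
  then have "even_sum l = even_sum (k - 1) + (\<Sum>i=k..l. digit_prod (2 * i))"
    unfolding even_sum_def by (simp add: sum.union_disjoint)
  ultimately show ?thesis using bc by simp
qed

end

theory Submission
  imports Defs
begin

text \<open>Split the last digit off every number: \<open>p = 10 * r + d\<close>. The digit product then factors as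
  \<open>C(p) = d * C(r)\<close>. Summing over complete blocks of ten consecutive numbers therefore multiplies
  the sum over the prefixes \<open>r\<close> by \<open>0 + 1 + \<dots> + 9 = 45\<close>, or by \<open>0 + 2 + 4 + 6 + 8 = 20\<close> if only
  even \<open>p\<close> count; the last, incomplete block has the fixed prefix \<open>q\<close> and contributes \<open>C(q)\<close> times
  a partial sum of digits (\<open>digit_block_sum\<close>).

  Let \<open>T(q)\<close> be the sum of \<open>C(r)\<close> over \<open>0 \<le> r < q\<close>, where \<open>C(0) = 1\<close> as an empty product. With
  \<open>2 n = 10 * q + a\<^sub>0\<close> this gives \<open>a(n) = 20 * T(q) + C(q) * (a\<^sub>0\<^sup>2/4 + a\<^sub>0/2)\<close> (\<open>even_sum_split\<close>)
  and, when \<open>10 * q + d > 0\<close>, \<open>T(10 * q + d) = 1 + 45 * T(q) + C(q) * d * (d - 1) / 2\<close>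
  (\<open>digit_prod_sum_split\<close>). The second relation is a Horner scheme in the decimal digits of \<open>q\<close>;
  solving it yields the closed form \<open>digit_prod_sum_closed_form\<close>, in which the summands \<open>1\<close> add up
  to the geometric sum \<open>(45\<^sup>L - 1) / 44\<close> for \<open>L\<close> digits. Substituting it into the first relation
  gives the theorem, since \<open>20 / 44 = 5 / 11\<close> and
  \<open>20 * 45\<^bsup>k-1\<^esup> / 2 = 2 * 5\<^sup>k * 9\<^bsup>k-1\<^esup>\<close>.\<close>

lemma num_digits_append:
  assumes "d < 10" "0 < 10 * r + d"
  shows "num_digits (10 * r + d) = Suc (num_digits r)"
proof -
  \<comment> \<open>Some exponent has to be admissible before the least one can be shifted by one.\<close>
  have "10 * r + d < 10 ^ (10 * r + d)"
    by (rule less_exp[THEN less_le_trans]) (simp add: power_mono)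
  then have "num_digits (10 * r + d) = Suc (LEAST k. 10 * r + d < 10 ^ Suc k)"
    unfolding num_digits_def using assms(2) by (intro Least_Suc) auto
  also have "(\<lambda>k. 10 * r + d < 10 ^ Suc k) = (\<lambda>k. r < 10 ^ k)"
    using assms(1) by (intro ext) (simp, linarith)
  finally show ?thesis by (simp add: num_digits_def)
qed

text \<open>The case \<open>r = 0\<close> is covered because \<open>0\<close> has no digits, so that \<open>digit_prod 0 = 1\<close>. Only the
  number \<open>0 = 10 * 0 + 0\<close> itself violates the equation.\<close>

lemma digit_prod_append:
  assumes "d < 10" "0 < 10 * r + d"
  shows "digit_prod (10 * r + d) = d * digit_prod r"
proof -
  have "digit (10 * r + d) 0 = d" "\<And>k. digit (10 * r + d) (Suc k) = digit r k"
    using assms(1) by (simp_all add: digit_def div_mult2_eq)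
  then show ?thesis
    by (simp add: digit_prod_def num_digits_append[OF assms] prod.lessThan_Suc_shift
        del: prod.lessThan_Suc)
qed

lemma digit_prod_0 [simp]: "digit_prod 0 = 1"
  by (simp add: digit_prod_def num_digits_def)

lemma digit_prod_expansion:
  assumes "\<And>k. k < L \<Longrightarrow> b k \<le> 9" "L \<noteq> 0 \<Longrightarrow> b (L - 1) \<noteq> 0"
  shows "digit_prod (\<Sum>k<L. b k * 10 ^ k) = (\<Prod>k<L. b k)"
    and "L \<noteq> 0 \<Longrightarrow> 0 < (\<Sum>k<L. b k * 10 ^ k)"
proof -
  have "digit_prod (\<Sum>k<L. b k * 10 ^ k) = (\<Prod>k<L. b k) \<and>
      (L \<noteq> 0 \<longrightarrow> 0 < (\<Sum>k<L. b k * 10 ^ k))"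
    using assms
  proof (induction L arbitrary: b)
    case 0
    show ?case by simp
  next
    case (Suc L)
    let ?q = "\<Sum>k<L. b (Suc k) * 10 ^ k"
    have IH: "digit_prod ?q = (\<Prod>k<L. b (Suc k))" "L \<noteq> 0 \<longrightarrow> 0 < ?q"
      using Suc.IH[of "\<lambda>k. b (Suc k)"] Suc.prems by auto
    have split: "(\<Sum>k<Suc L. b k * 10 ^ k) = 10 * ?q + b 0"
      by (simp add: sum.lessThan_Suc_shift sum_distrib_left mult_ac del: sum.lessThan_Suc)
    have pos: "0 < 10 * ?q + b 0"
      using IH(2) Suc.prems(2) by (cases "L = 0") auto
    have "b 0 < 10" using Suc.prems(1)[of 0] by simp
    from digit_prod_append[OF this pos] show ?case
      using pos unfolding split IH(1)
      by (simp add: prod.lessThan_Suc_shift del: prod.lessThan_Suc)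
  qed
  then show "digit_prod (\<Sum>k<L. b k * 10 ^ k) = (\<Prod>k<L. b k)"
    and "L \<noteq> 0 \<Longrightarrow> 0 < (\<Sum>k<L. b k * 10 ^ k)" by auto
qed

text \<open>Each of the \<open>q\<close> complete blocks of length \<open>B\<close> contributes its value \<open>h r\<close> times the same sum
  of \<open>g\<close>; the last \<open>c\<close> arguments form the beginning of the block with value \<open>h q\<close>.\<close>

lemma digit_block_sum:
  fixes f g h :: "nat \<Rightarrow> nat"
  assumes factor: "\<And>r d. d < B \<Longrightarrow> f (B * r + d) = g d * h r" and "c \<le> B"
  shows "(\<Sum>p<B * q + c. f p) = (\<Sum>d<B. g d) * (\<Sum>r<q. h r) + (\<Sum>d<c. g d) * h q"
proof -
  have partial: "(\<Sum>p<B * q + c. f p) = (\<Sum>p<B * q. f p) + (\<Sum>d<c. g d) * h q"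
    if "c \<le> B" for q c
    using that by (induction c) (simp_all add: factor distrib_right)
  have "(\<Sum>p<B * q. f p) = (\<Sum>d<B. g d) * (\<Sum>r<q. h r)"
  proof (induction q)
    case (Suc q)
    then show ?case
      using partial[of B q] by (simp add: algebra_simps)
  qed simp
  then show ?thesis using partial[OF \<open>c \<le> B\<close>] by simp
qed

lemma digit_prod_sum_split:
  assumes "d < 10" "0 < 10 * q + d"
  shows "real (\<Sum>r<10 * q + d. digit_prod r) =
    1 + 45 * real (\<Sum>r<q. digit_prod r) + real (digit_prod q) * (real d * (real d - 1) / 2)"
proof -
  obtain N where N: "10 * q + d = Suc N"
    using gr0_implies_Suc[OF assms(2)] by (elim exE)
  \<comment> \<open>Replacing the value \<open>1\<close> at \<open>0\<close> by \<open>0\<close> makes the factorisation hold without exception.\<close>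
  define f where "f p = (if p = 0 then 0 else digit_prod p)" for p
  have "f (10 * r + e) = e * digit_prod r" if "e < 10" for r e
    using digit_prod_append[OF that] by (auto simp: f_def)
  then have "(\<Sum>p<10 * q + d. f p) =
      (\<Sum>e<10. e) * (\<Sum>r<q. digit_prod r) + (\<Sum>e<d. e) * digit_prod q"
    using assms(1) by (intro digit_block_sum) auto
  moreover have "(\<Sum>e<10. e) = (45::nat)" by (simp add: eval_nat_numeral)
  moreover have "real (\<Sum>e<d. e) = real d * (real d - 1) / 2"
    by (induction d) (simp_all add: field_simps)
  moreover have "(\<Sum>p<10 * q + d. digit_prod p) = 1 + (\<Sum>p<10 * q + d. f p)"
    unfolding N sum.lessThan_Suc_shift by (simp add: f_def)
  ultimately show ?thesis by (simp del: of_nat_sum)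
qed

text \<open>With the sum over even numbers indexed by their halves, the blocks have length five: the
  numbers \<open>2 * (5 * q + e)\<close> with \<open>e < 5\<close> are those with prefix \<open>q\<close> and last digit \<open>2 * e\<close>.\<close>

lemma even_sum_split:
  assumes "e < 5"
  shows "even_sum (5 * q + e) = 20 * (\<Sum>r<q. digit_prod r) + e * (e + 1) * digit_prod q"
proof -
  define f where "f i = (if i = 0 then 0 else digit_prod (2 * i))" for i
  have "f (5 * r + d) = 2 * d * digit_prod r" if "d < 5" for r d
    using digit_prod_append[of "2 * d" r] that by (auto simp: f_def)
  then have "(\<Sum>i<5 * q + Suc e. f i) =
      (\<Sum>d<5. 2 * d) * (\<Sum>r<q. digit_prod r) + (\<Sum>d<Suc e. 2 * d) * digit_prod q"
    using assms by (intro digit_block_sum) auto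
  moreover have "(\<Sum>d<5. 2 * d) = (20::nat)" by (simp add: eval_nat_numeral)
  moreover have "(\<Sum>d<Suc e. 2 * d) = e * (e + 1)"
    by (induction e) simp_all
  moreover have "even_sum (5 * q + e) = (\<Sum>i<5 * q + Suc e. f i)"
  proof -
    have "even_sum N = (\<Sum>i<Suc N. f i)" for N
      by (induction N) (simp_all add: even_sum_def f_def)
    then show ?thesis by simp
  qed
  ultimately show ?thesis by simp
qed

text \<open>The \<open>k\<close>-th summand collects the numbers that agree with the given one above position \<open>k\<close>
  and have a smaller nonzero digit there, the \<open>k\<close> lower digits being free. The numbers with fewer
  than \<open>L\<close> digits, \<open>0\<close> among them, make up \<open>1 + 45 + \<dots> + 45\<^bsup>L-1\<^esup>\<close>. Passing from \<open>L\<close> to \<open>L + 1\<close> appends a digit at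
  the low end, so that the digits already present move up by one position.\<close>

lemma digit_prod_sum_closed_form:
  assumes "\<And>k. k < L \<Longrightarrow> b k \<le> 9" "L \<noteq> 0 \<Longrightarrow> b (L - 1) \<noteq> 0"
  shows "real (\<Sum>r<(\<Sum>k<L. b k * 10 ^ k). digit_prod r) =
    (45 ^ L - 1) / 44 +
    (\<Sum>k<L. (\<Prod>j\<in>{k<..<L}. real (b j)) * (45 ^ k * (real (b k) * (real (b k) - 1) / 2)))"
  using assms
proof (induction L arbitrary: b)
  case 0
  show ?case by simp
next
  case (Suc L)
  let ?b = "\<lambda>k. b (Suc k)"
  let ?q = "\<Sum>k<L. ?b k * 10 ^ k"
  let ?v = "\<lambda>k. real (b k) * (real (b k) - 1) / 2"
  have split: "(\<Sum>k<Suc L. b k * 10 ^ k) = 10 * ?q + b 0"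
    by (simp add: sum.lessThan_Suc_shift sum_distrib_left mult_ac del: sum.lessThan_Suc)
  have pos: "0 < 10 * ?q + b 0"
    using digit_prod_expansion(2)[of "Suc L" b] Suc.prems unfolding split by simp
  have shift: "(\<Prod>j\<in>{k<..<Suc L}. real (b j)) = (\<Prod>j\<in>{k..<L}. real (?b j))" for k
    by (rule prod.reindex_bij_witness[of _ Suc "\<lambda>j. j - 1"]) auto
  have prefix: "real (digit_prod ?q) = (\<Prod>j\<in>{0<..<Suc L}. real (b j))"
    using digit_prod_expansion(1)[of L ?b] Suc.prems
    by (auto simp: shift atLeast0LessThan)
  have upper: "(\<Prod>j\<in>{Suc k<..<Suc L}. real (b j)) = (\<Prod>j\<in>{k<..<L}. real (?b j))" for k
    unfolding shift by (rule prod.cong) auto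
  have "real (\<Sum>r<(\<Sum>k<Suc L. b k * 10 ^ k). digit_prod r) =
      1 + 45 * real (\<Sum>r<?q. digit_prod r) + real (digit_prod ?q) * ?v 0"
    unfolding split using Suc.prems(1)[of 0] pos by (intro digit_prod_sum_split) auto
  also have "real (\<Sum>r<?q. digit_prod r) =
      (45 ^ L - 1) / 44 + (\<Sum>k<L. (\<Prod>j\<in>{k<..<L}. real (?b j)) * (45 ^ k * ?v (Suc k)))"
    using Suc.prems by (intro Suc.IH) auto
  also have "1 + 45 * \<dots> = (45 ^ Suc L - 1) / 44 +
      (\<Sum>k<L. (\<Prod>j\<in>{k<..<L}. real (?b j)) * (45 ^ Suc k * ?v (Suc k)))"
    by (simp add: sum_distrib_left field_simps)
  finally show ?case
    by (simp add: sum.lessThan_Suc_shift upper prefix del: sum.lessThan_Suc of_nat_sum)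
qed

theorem theorem2:
  fixes n m :: nat and a :: "nat \<Rightarrow> nat"
  assumes "n \<ge> 1"
    and "2 * n = (\<Sum>k=0..m. a k * 10 ^ k)"
    and "\<And>k. k \<le> m \<Longrightarrow> a k \<le> 9"
    and "a m \<noteq> 0"
  shows "even_sum n = between_sum 2 (2 * n)
    \<and> between_sum 2 (2 * n) = between_sum 2 (\<Sum>k=0..m. a k * 10 ^ k)
    \<and> real (even_sum n) =
      5 / 11 * (45 ^ m - 1)
      + (\<Sum>k=1..m. (\<Prod>j\<in>{k<..m}. real (a j))
                     * (2 * 5 ^ k * 9 ^ (k - 1) * real (a k) * (real (a k) - 1)))
      + (\<Prod>i=1..m. real (a i)) * ((real (a 0))\<^sup>2 / 4 + real (a 0) / 2)"
proof (intro conjI)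
  have "int (between_sum 2 (2 * n)) = int (even_sum n)"
    using between_sum_eq_diff[of 2 "2 * n"] assms(1) by (simp add: even_sum_def)
  then show "even_sum n = between_sum 2 (2 * n)" by simp
  show "between_sum 2 (2 * n) = between_sum 2 (\<Sum>k=0..m. a k * 10 ^ k)"
    by (simp add: assms(2))
next
  let ?a = "\<lambda>k. a (Suc k)"
  define q where "q = (\<Sum>k<m. ?a k * 10 ^ k)"
  have n: "2 * n = 10 * q + a 0"
    unfolding assms(2) q_def atLeast0AtMost lessThan_Suc_atMost[symmetric]
    by (simp add: sum.lessThan_Suc_shift sum_distrib_left mult_ac del: sum.lessThan_Suc)
  then have "even (a 0)" by presburger
  then obtain e where e: "a 0 = 2 * e" by (elim evenE)
  have e5: "e < 5" and n': "n = 5 * q + e"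
    using assms(3)[of 0] n e by auto
  have digits: "\<And>k. k < m \<Longrightarrow> ?a k \<le> 9" "m \<noteq> 0 \<Longrightarrow> ?a (m - 1) \<noteq> 0"
    using assms(3,4) by auto
  have prod_shift: "(\<Prod>j\<in>{Suc k<..m}. real (a j)) = (\<Prod>j\<in>{k<..<m}. real (?a j))" for k
    by (rule prod.reindex_bij_witness[of _ Suc "\<lambda>j. j - 1"]) auto
  have "digit_prod q = (\<Prod>k<m. ?a k)"
    using digit_prod_expansion(1)[of m ?a] digits by (auto simp: q_def)
  also have "\<dots> = (\<Prod>i=1..m. a i)"
    by (rule prod.reindex_bij_witness[of _ "\<lambda>j. j - 1" Suc]) auto
  finally have prod_q: "real (digit_prod q) = (\<Prod>i=1..m. real (a i))" by simp
  have T: "real (\<Sum>r<q. digit_prod r) = (45 ^ m - 1) / 44 + (\<Sum>k<m. (\<Prod>j\<in>{k<..<m}. real (?a j))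
          * (45 ^ k * (real (?a k) * (real (?a k) - 1) / 2)))"
    unfolding q_def using digits by (intro digit_prod_sum_closed_form[of m ?a]) auto
  have weight: "5 ^ k * 9 ^ k = (45::real) ^ k" for k
    using power_mult_distrib[of "5::real" 9 k] by simp
  have "(\<Sum>k=1..m. (\<Prod>j\<in>{k<..m}. real (a j))
          * (2 * 5 ^ k * 9 ^ (k - 1) * real (a k) * (real (a k) - 1))) =
        (\<Sum>k<m. (\<Prod>j\<in>{k<..<m}. real (?a j))
          * (2 * 5 ^ Suc k * 9 ^ k * real (?a k) * (real (?a k) - 1)))"
    by (rule sum.reindex_bij_witness[of _ Suc "\<lambda>j. j - 1"])
      (auto simp flip: prod_shift)
  also have "\<dots> = 20 * (\<Sum>k<m. (\<Prod>j\<in>{k<..<m}. real (?a j))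
          * (45 ^ k * (real (?a k) * (real (?a k) - 1) / 2)))"
    unfolding sum_distrib_left by (intro sum.cong refl) (simp flip: weight)
  finally have "20 * real (\<Sum>r<q. digit_prod r) = 5 / 11 * (45 ^ m - 1)
      + (\<Sum>k=1..m. (\<Prod>j\<in>{k<..m}. real (a j))
          * (2 * 5 ^ k * 9 ^ (k - 1) * real (a k) * (real (a k) - 1)))"
    using T by (simp del: of_nat_sum)
  moreover have "real (even_sum n) =
      20 * real (\<Sum>r<q. digit_prod r) + real (digit_prod q) * (real e * (real e + 1))"
    unfolding n' even_sum_split[OF e5] by (simp add: algebra_simps)
  moreover have "real e * (real e + 1) = (real (a 0))\<^sup>2 / 4 + real (a 0) / 2"
    by (simp add: e power2_eq_square algebra_simps)
  ultimately show "real (even_sum n) =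
      5 / 11 * (45 ^ m - 1)
      + (\<Sum>k=1..m. (\<Prod>j\<in>{k<..m}. real (a j))
                     * (2 * 5 ^ k * 9 ^ (k - 1) * real (a k) * (real (a k) - 1)))
      + (\<Prod>i=1..m. real (a i)) * ((real (a 0))\<^sup>2 / 4 + real (a 0) / 2)"
    by (simp only: prod_q)
qed

end
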